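(* For $R>0$ let $M_{\Delta}(R)$ be the supremum of $|A|$ over all measurable sets $A\subseteq[0,R]^2$ that contain no three points spanning a triangle of area $1$. Then there exists an absolute constant $C>0$ such that for every real $R\geq 10$, \[ M_{\Delta}(R) \leq C\, R^2\Bigl(\frac{\log\log R}{\log R}\Bigr)^{1/2}. \]
   Context: $|A|$ denotes the Lebesgue measure of a measurable set $A\subseteq\mathbb{R}^2$; $\log$ is the natural logarithm. Triangles may be arbitrarily positioned, rotated and scalene; only their area is prescribed. *)

theory Defs
  imports "HOL-Analysis.Analysis"
begin

definition triangle_area :: "real^2 \<Rightarrow> real^2 \<Rightarrow> real^2 \<Rightarrow> real" where
  "triangle_area a b c = measure lebesgue (convex hull {a, b, c})"

text \<open>
  Degenerate triples need not be excluded separately: collinear or coinciding points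
  have \<^term>\<open>triangle_area a b c = 0\<close>.
\<close>

definition avoids_unit_triangles :: "(real^2) set \<Rightarrow> bool" where
  "avoids_unit_triangles A \<longleftrightarrow> (\<forall>a\<in>A. \<forall>b\<in>A. \<forall>c\<in>A. triangle_area a b c \<noteq> 1)"

definition square :: "real \<Rightarrow> (real^2) set" where
  "square R = {x. \<forall>i. 0 \<le> x $ i \<and> x $ i \<le> R}"

definition admissible :: "real \<Rightarrow> (real^2) set set" where
  "admissible R = {A. A \<in> sets lebesgue \<and> A \<subseteq> square R \<and> avoids_unit_triangles A}"

definition M_Delta :: "real \<Rightarrow> real" where
  "M_Delta R = (SUP A\<in>admissible R. measure lebesgue A)"

text \<open>
  The supremum is that of a nonempty set of reals which is bounded above, so it is a genuine
  least upper bound.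
\<close>

lemma square_eq_cbox: "square R = cbox 0 (\<chi> i. R)"
  by (auto simp: square_def mem_box_cart)

lemma admissible_nonempty: "admissible R \<noteq> {}"
proof -
  have "{} \<in> admissible R"
    by (simp add: admissible_def avoids_unit_triangles_def)
  then show ?thesis by blast
qed

lemma bdd_above_admissible: "bdd_above (measure lebesgue ` admissible R)"
proof (rule bdd_aboveI2)
  fix A assume A: "A \<in> admissible R"
  show "measure lebesgue A \<le> measure lebesgue (square R)"
  proof (rule measure_mono_fmeasurable)
    show "A \<subseteq> square R" "A \<in> sets lebesgue" using A by (auto simp: admissible_def)
    show "square R \<in> lmeasurable" by (simp add: square_eq_cbox)
  qed
qed

end

theory Submission
  imports Defs
begin

text \<open>
  The bound comes from a power saving: an admissible set in the square of side \<open>R\<close> has measure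
  at most \<open>21 R\<^sup>5\<^sup>/\<^sup>3\<close>, which is far below \<open>R\<^sup>2 (log log R / log R)\<^sup>1\<^sup>/\<^sup>2\<close>. Two properties of
  the chord lengths of \<open>A\<close> collide.

  Let \<open>G p m\<close> be the length, measured by the first coordinate, of the part of \<open>A\<close> on the line
  \<open>q = p + m u\<close>, for slopes \<open>m\<close> in \<open>[0, 1]\<close>. If two points of \<open>A\<close> on this line have first
  coordinates differing by \<open>s\<close>, every point of the line \<open>q = p + 2/s + m u\<close> spans with them a
  triangle of area 1. So that parallel line misses \<open>A\<close>, and \<open>G (p + 2/s) m = 0\<close>. A line with
  \<open>G p m \<ge> t\<close> realises a set of differences \<open>s\<close> of measure at least of order \<open>t\<close>, even after
  those with \<open>\<bar>s\<bar> < t/4\<close> are discarded (lemma \<open>empty_translates_measure\<close>). Hence \<open>G\<close> jumps to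
  zero under many vertical translations by \<open>2/s\<close>, all of size at most \<open>8/t\<close>.

  On the other hand \<open>G\<close> varies slowly in \<open>p\<close> on average over \<open>m\<close>: a line integral gains
  regularity when the direction is averaged, as for the X-ray transform. Concretely, expanding
  the correlation of \<open>G\<close> with its translate by \<open>y\<close> gives pairs of points of \<open>A\<close> with abscissae
  \<open>u, v\<close>, and moving the second point vertically by \<open>y\<close> amounts to changing the slope by
  \<open>y / (v - u)\<close>. For \<open>\<bar>v - u\<bar> \<ge> 1\<close> this costs at most \<open>\<bar>y\<bar>\<close> in the average over slopes; the pairs
  with \<open>\<bar>v - u\<bar> \<le> 1\<close> are few. So the correlation changes by at most \<open>\<bar>A\<bar> (2 + R \<bar>y\<bar>)\<close>
  (lemma \<open>line_corr_shift\<close>), and this bounds the integral of \<open>G\<^sup>2\<close> over the lines whose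
  \<open>y\<close>-translate is empty (lemma \<open>lines_with_empty_translate\<close>).

  Integrating the last bound over \<open>y = 2/s\<close>, with \<open>t = \<bar>A\<bar> / (4 R)\<close>, and comparing with the
  first property yields \<open>t\<^sup>2 \<bar>A\<bar> / 4 \<le> 4 R \<bar>A\<bar> (2 + 8 R / t)\<close>, whence \<open>t\<^sup>3\<close> is at most of order
  \<open>R\<^sup>2\<close>, that is, \<open>\<bar>A\<bar>\<^sup>3\<close> is at most of order \<open>R\<^sup>5\<close>.
\<close>

section \<open>Line masses and their correlations\<close>

text \<open>
  Lines are indexed by intercept and slope rather than by distance and angle: shearing preserves
  area, so the vertical offset \<open>2/s\<close> that produces area 1 does not depend on the slope. The
  restriction to slopes in \<open>[0, 1]\<close> is part of the function, so that all integrals below run over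
  the whole real line.
\<close>
definition line_mass :: "(real \<Rightarrow> real \<Rightarrow> ennreal) \<Rightarrow> real \<Rightarrow> real \<Rightarrow> ennreal" where
  "line_mass f p m = indicator {0..1} m * (\<integral>\<^sup>+u. f u (p + m * u) \<partial>lborel)"

definition total_mass :: "(real \<Rightarrow> real \<Rightarrow> ennreal) \<Rightarrow> ennreal" where
  "total_mass f = (\<integral>\<^sup>+u. \<integral>\<^sup>+q. f u q \<partial>lborel \<partial>lborel)"

definition line_corr :: "(real \<Rightarrow> real \<Rightarrow> ennreal) \<Rightarrow> real \<Rightarrow> ennreal" where
  "line_corr f y = (\<integral>\<^sup>+m. \<integral>\<^sup>+p. line_mass f p m * line_mass f (p + y) m \<partial>lborel \<partial>lborel)"

lemma nn_integral_translate:
  fixes g :: "real \<Rightarrow> ennreal"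
  assumes [measurable]: "g \<in> borel_measurable borel"
  shows "(\<integral>\<^sup>+x. g (x + c) \<partial>lborel) = (\<integral>\<^sup>+x. g x \<partial>lborel)"
  using nn_integral_real_affine[of g 1 c] by (simp add: add.commute)

lemma nn_integral_swap:
  fixes g :: "real \<Rightarrow> real \<Rightarrow> ennreal"
  assumes "(\<lambda>(x, y). g x y) \<in> borel_measurable (borel \<Otimes>\<^sub>M borel)"
  shows "(\<integral>\<^sup>+y. \<integral>\<^sup>+x. g x y \<partial>lborel \<partial>lborel) = (\<integral>\<^sup>+x. \<integral>\<^sup>+y. g x y \<partial>lborel \<partial>lborel)"
  by (rule lborel_pair.Fubini') (use assms in measurable)

text \<open>
  Translating the window \<open>[0, 1]\<close> by \<open>h\<close> loses only a piece of length at most \<open>\<bar>h\<bar>\<close>, on which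
  the integrand is at most 1. This is the whole source of smoothness in the argument.
\<close>
lemma unit_interval_shift:
  fixes g :: "real \<Rightarrow> ennreal"
  assumes [measurable]: "g \<in> borel_measurable borel" and le1: "\<And>x. g x \<le> 1"
  shows "(\<integral>\<^sup>+m. indicator {0..1} m * g m \<partial>lborel)
    \<le> (\<integral>\<^sup>+m. indicator {0..1} m * g (m + h) \<partial>lborel) + ennreal \<bar>h\<bar>"
proof -
  have "(\<integral>\<^sup>+m. indicator {0..1} m * g m \<partial>lborel)
     \<le> (\<integral>\<^sup>+m. indicator {h..1+h} m * g m + indicator (if h \<ge> 0 then {0..h} else {1+h..1}) m \<partial>lborel)"
  proof (rule nn_integral_mono)
    fix m :: real
    show "indicator {0..1} m * g m \<le> indicator {h..1+h} m * g m
       + indicator (if h \<ge> 0 then {0..h} else {1+h..1}) m"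
      using le1[of m] by (auto simp: indicator_def)
  qed
  also have "\<dots> = (\<integral>\<^sup>+m. indicator {h..1+h} m * g m \<partial>lborel) + ennreal \<bar>h\<bar>"
    by (subst nn_integral_add) (auto simp: emeasure_lborel_Icc_eq)
  also have "(\<integral>\<^sup>+m. indicator {h..1+h} m * g m \<partial>lborel)
     = (\<integral>\<^sup>+m. indicator {h..1+h} (m + h) * g (m + h) \<partial>lborel)"
    by (rule nn_integral_translate[symmetric]) measurable
  also have "\<dots> = (\<integral>\<^sup>+m. indicator {0..1} m * g (m + h) \<partial>lborel)"
    by (intro nn_integral_cong) (auto simp: indicator_def)
  finally show ?thesis .
qed

lemma ennreal_two_mult_le: 
  fixes a b :: ennreal
  shows "2 * (a * b) \<le> a * a + b * b"
proof (cases "a = top \<or> b = top")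
  case True
  then show ?thesis by (auto simp: ennreal_top_mult)
next
  case False
  then obtain x y where "a = ennreal x" "b = ennreal y" "x \<ge> 0" "y \<ge> 0"
    by (metis ennreal_cases)
  moreover have "2 * (x * y) \<le> x * x + y * y"
    using sum_squares_bound[of x y] by (simp add: power2_eq_square)
  ultimately show ?thesis
    by (simp flip: ennreal_mult ennreal_plus ennreal_numeral add: ennreal_leI)
qed

locale planar_density =
  fixes f :: "real \<Rightarrow> real \<Rightarrow> ennreal" and R :: real
  assumes f_meas [measurable]: "(\<lambda>(u, q). f u q) \<in> borel_measurable (borel \<Otimes>\<^sub>M borel)"
    and f_le1: "f u q \<le> 1"
    and f_supp: "f u q \<noteq> 0 \<Longrightarrow> u \<in> {0..R} \<and> q \<in> {0..R}"
    and R_pos: "R > 0"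
begin

lemma f_meas_comp [measurable (raw)]:
  assumes [measurable]: "g \<in> borel_measurable M" "h \<in> borel_measurable M"
  shows "(\<lambda>x. f (g x) (h x)) \<in> borel_measurable M"
  using measurable_compose[OF measurable_Pair[OF assms] f_meas] by simp

lemma line_mass_meas [measurable]:
  "(\<lambda>(p, m). line_mass f p m) \<in> borel_measurable (borel \<Otimes>\<^sub>M borel)"
  unfolding line_mass_def by measurable

lemma line_mass_meas_comp [measurable (raw)]:
  assumes [measurable]: "g \<in> borel_measurable M" "h \<in> borel_measurable M"
  shows "(\<lambda>x. line_mass f (g x) (h x)) \<in> borel_measurable M"
  using measurable_compose[OF measurable_Pair[OF assms] line_mass_meas] by simp

text \<open>
  For each fixed slope the lines partition the plane, and the interval of slopes has length 1.
\<close>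
lemma integral_line_mass:
  "(\<integral>\<^sup>+m. \<integral>\<^sup>+p. line_mass f p m \<partial>lborel \<partial>lborel) = total_mass f"
proof -
  have "(\<integral>\<^sup>+p. line_mass f p m \<partial>lborel) = indicator {0..1} m * total_mass f" for m
  proof -
    have "(\<integral>\<^sup>+p. \<integral>\<^sup>+u. f u (p + m * u) \<partial>lborel \<partial>lborel)
        = (\<integral>\<^sup>+u. \<integral>\<^sup>+p. f u (p + m * u) \<partial>lborel \<partial>lborel)"
      by (rule nn_integral_swap) measurable
    also have "\<dots> = total_mass f"
      unfolding total_mass_def by (intro nn_integral_cong nn_integral_translate) measurable
    finally show ?thesis
      unfolding line_mass_def by (subst nn_integral_cmult) auto
  qed
  then show ?thesis
    by (simp add: nn_integral_multc)
qed

text \<open>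
  A pair of points with abscissae \<open>u\<close> and \<open>v\<close>, one on a line and one on its translate by \<open>y\<close>, is
  described by the height \<open>q\<close> of the first point instead of the intercept. Then the slope occurs
  only in the second factor and can be averaged first.
\<close>
lemma line_corr_eq:
  "line_corr f y = (\<integral>\<^sup>+u. \<integral>\<^sup>+v. \<integral>\<^sup>+q. f u q *
      (\<integral>\<^sup>+m. indicator {0..1} m * f v (q + y + m * (v - u)) \<partial>lborel) \<partial>lborel \<partial>lborel \<partial>lborel)"
proof -
  have 1: "(\<integral>\<^sup>+p. line_mass f p m * line_mass f (p + y) m \<partial>lborel)
      = (\<integral>\<^sup>+u. \<integral>\<^sup>+v. \<integral>\<^sup>+q. indicator {0..1} m * (f u q * f v (q + y + m * (v - u)))
           \<partial>lborel \<partial>lborel \<partial>lborel)" (is "?L m = ?Rr m") for m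
  proof -
    have "line_mass f p m * line_mass f (p + y) m =
        (\<integral>\<^sup>+u. \<integral>\<^sup>+v. indicator {0..1} m * (f u (p + m * u) * f v (p + y + m * v))
            \<partial>lborel \<partial>lborel)" for p
      unfolding line_mass_def
      by (simp add: nn_integral_cmult nn_integral_multc indicator_def)
    then have "?L m = (\<integral>\<^sup>+p. \<integral>\<^sup>+u. \<integral>\<^sup>+v. indicator {0..1} m *
        (f u (p + m * u) * f v (p + y + m * v)) \<partial>lborel \<partial>lborel \<partial>lborel)"
      by simp
    also have "\<dots> = (\<integral>\<^sup>+u. \<integral>\<^sup>+p. \<integral>\<^sup>+v. indicator {0..1} m *
        (f u (p + m * u) * f v (p + y + m * v)) \<partial>lborel \<partial>lborel \<partial>lborel)"
      by (rule nn_integral_swap) measurable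
    also have "\<dots> = (\<integral>\<^sup>+u. \<integral>\<^sup>+v. \<integral>\<^sup>+p. indicator {0..1} m *
        (f u (p + m * u) * f v (p + y + m * v)) \<partial>lborel \<partial>lborel \<partial>lborel)"
      by (intro nn_integral_cong nn_integral_swap) measurable
    also have "\<dots> = ?Rr m"
    proof (rule nn_integral_cong, rule nn_integral_cong)
      fix u v :: real
      have "(\<integral>\<^sup>+p. indicator {0..1} m * (f u (p + m * u) * f v (p + y + m * v)) \<partial>lborel)
        = (\<integral>\<^sup>+p. indicator {0..1} m * (f u (p + m * u) * f v ((p + m * u) + y + m * (v - u))) \<partial>lborel)"
        by (simp add: algebra_simps)
      also have "\<dots> = (\<integral>\<^sup>+q. indicator {0..1} m * (f u q * f v (q + y + m * (v - u))) \<partial>lborel)"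
        by (rule nn_integral_translate[where
              g = "\<lambda>q. indicator {0..1} m * (f u q * f v (q + y + m * (v - u)))"]) measurable
      finally show "(\<integral>\<^sup>+p. indicator {0..1} m * (f u (p + m * u) * f v (p + y + m * v)) \<partial>lborel)
        = (\<integral>\<^sup>+q. indicator {0..1} m * (f u q * f v (q + y + m * (v - u))) \<partial>lborel)" .
    qed
    finally show ?thesis .
  qed
  have "line_corr f y = (\<integral>\<^sup>+m. ?Rr m \<partial>lborel)"
    unfolding line_corr_def 1 ..
  also have "\<dots> = (\<integral>\<^sup>+u. \<integral>\<^sup>+m. \<integral>\<^sup>+v. \<integral>\<^sup>+q. indicator {0..1} m * (f u q * f v (q + y + m * (v - u)))
           \<partial>lborel \<partial>lborel \<partial>lborel \<partial>lborel)"
    by (rule nn_integral_swap) measurable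
  also have "\<dots> = (\<integral>\<^sup>+u. \<integral>\<^sup>+v. \<integral>\<^sup>+m. \<integral>\<^sup>+q. indicator {0..1} m * (f u q * f v (q + y + m * (v - u)))
           \<partial>lborel \<partial>lborel \<partial>lborel \<partial>lborel)"
    by (intro nn_integral_cong nn_integral_swap) measurable
  also have "\<dots> = (\<integral>\<^sup>+u. \<integral>\<^sup>+v. \<integral>\<^sup>+q. \<integral>\<^sup>+m. indicator {0..1} m * (f u q * f v (q + y + m * (v - u)))
           \<partial>lborel \<partial>lborel \<partial>lborel \<partial>lborel)"
    by (intro nn_integral_cong nn_integral_swap) measurable
  also have "\<dots> = (\<integral>\<^sup>+u. \<integral>\<^sup>+v. \<integral>\<^sup>+q. f u q *
      (\<integral>\<^sup>+m. indicator {0..1} m * f v (q + y + m * (v - u)) \<partial>lborel) \<partial>lborel \<partial>lborel \<partial>lborel)"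
  proof (rule nn_integral_cong, rule nn_integral_cong, rule nn_integral_cong)
    fix u v q :: real
    have "f u q * (\<integral>\<^sup>+m. indicator {0..1} m * f v (q + y + m * (v - u)) \<partial>lborel)
      = (\<integral>\<^sup>+m. f u q * (indicator {0..1} m * f v (q + y + m * (v - u))) \<partial>lborel)"
      by (rule nn_integral_cmult[symmetric]) measurable
    then show "(\<integral>\<^sup>+m. indicator {0..1} m * (f u q * f v (q + y + m * (v - u))) \<partial>lborel)
      = f u q * (\<integral>\<^sup>+m. indicator {0..1} m * f v (q + y + m * (v - u)) \<partial>lborel)"
      by (simp only: mult.left_commute)
  qed
  finally show ?thesis .
qed

text \<open>
  A vertical displacement by \<open>y\<close> at horizontal distance \<open>v - u\<close> is the change of slope
  \<open>y / (v - u)\<close>, which is harmless unless \<open>v\<close> is close to \<open>u\<close>; the cut-off at distance 1 leaves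
  an exceptional interval of length 2.
\<close>
lemma slope_average_le:
  "(\<integral>\<^sup>+m. indicator {0..1} m * f v (q + m * (v - u)) \<partial>lborel)
   \<le> (\<integral>\<^sup>+m. indicator {0..1} m * f v (q + y + m * (v - u)) \<partial>lborel)
      + (indicator {-1..1} (v - u) + ennreal \<bar>y\<bar> * indicator {0..R} v)" (is "?L \<le> ?M + _")
proof (cases "v \<in> {0..R}")
  case False
  then have "f v x = 0" for x using f_supp by blast
  then show ?thesis by simp
next
  case v: True
  show ?thesis
  proof (cases "\<bar>v - u\<bar> \<le> 1")
    case True
    have "?L \<le> (\<integral>\<^sup>+m. indicator {0..1::real} m \<partial>lborel)"
      by (intro nn_integral_mono) (use f_le1 in \<open>auto simp: indicator_def\<close>)
    also have "\<dots> = 1" by simp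
    also have "1 = (indicator {-1..1} (v - u) :: ennreal)"
      using True by (auto simp: indicator_def)
    also have "\<dots> \<le> ?M + (indicator {-1..1} (v - u) + ennreal \<bar>y\<bar> * indicator {0..R} v)"
      by (rule add_increasing, simp, rule add_increasing2) auto
    finally show ?thesis .
  next
    case False
    then have c: "v - u \<noteq> 0" and "1 \<le> \<bar>v - u\<bar>" by auto
    then have h: "\<bar>y / (v - u)\<bar> \<le> \<bar>y\<bar>"
      by (simp add: divide_le_eq mult_le_cancel_left1)
    have "?L \<le> (\<integral>\<^sup>+m. indicator {0..1} m * f v (q + (m + y / (v - u)) * (v - u)) \<partial>lborel)
        + ennreal \<bar>y / (v - u)\<bar>"
      by (rule unit_interval_shift) (use f_le1 in auto)
    also have "(\<integral>\<^sup>+m. indicator {0..1} m * f v (q + (m + y / (v - u)) * (v - u)) \<partial>lborel) = ?M"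
    proof (rule nn_integral_cong)
      fix m :: real
      have "q + (m + y / (v - u)) * (v - u) = q + y + m * (v - u)"
        using c by (simp add: distrib_right)
      then show "indicator {0..1} m * f v (q + (m + y / (v - u)) * (v - u))
          = indicator {0..1} m * f v (q + y + m * (v - u))"
        by (simp only:)
    qed
    also have "ennreal \<bar>y / (v - u)\<bar> \<le> ennreal \<bar>y\<bar>" using h by (rule ennreal_leI)
    also have "ennreal \<bar>y\<bar> \<le> indicator {-1..1} (v - u) + ennreal \<bar>y\<bar> * indicator {0..R} v"
      using v by (simp add: add_increasing)
    finally show ?thesis by (simp add: add_left_mono)
  qed
qed

lemma line_corr_shift:
  "line_corr f 0 \<le> line_corr f y + total_mass f * ennreal (2 + R * \<bar>y\<bar>)"
proof -
  let ?e = "\<lambda>u v. indicator {-1..1} (v - u) + ennreal \<bar>y\<bar> * indicator {0..R} v"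
  let ?S = "\<lambda>y u v q. \<integral>\<^sup>+m. indicator {0..1} m * f v (q + y + m * (v - u)) \<partial>lborel"
  have e: "(\<integral>\<^sup>+v. ?e u v \<partial>lborel) = ennreal (2 + R * \<bar>y\<bar>)" for u
  proof -
    have "(\<integral>\<^sup>+v. indicator {-1..1} (v - u) \<partial>lborel) = (2 :: ennreal)"
      using nn_integral_translate[of "indicator {-1..1}" "-u"] by simp
    then show ?thesis
      using R_pos by (simp add: nn_integral_add nn_integral_cmult mult.commute
          flip: ennreal_mult ennreal_plus ennreal_numeral)
  qed
  have "line_corr f 0 \<le> (\<integral>\<^sup>+u. \<integral>\<^sup>+v. \<integral>\<^sup>+q. f u q * (?S y u v q + ?e u v) \<partial>lborel \<partial>lborel \<partial>lborel)"
    unfolding line_corr_eq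
    by (rule nn_integral_mono, rule nn_integral_mono, rule nn_integral_mono, rule mult_left_mono)
       (simp_all add: slope_average_le)
  also have "\<dots> = (\<integral>\<^sup>+u. \<integral>\<^sup>+v. \<integral>\<^sup>+q. f u q * ?S y u v q + f u q * ?e u v \<partial>lborel \<partial>lborel \<partial>lborel)"
    by (simp only: distrib_left[of "f _ _" "?S _ _ _ _"])
  also have "\<dots> = (\<integral>\<^sup>+u. \<integral>\<^sup>+v. (\<integral>\<^sup>+q. f u q * ?S y u v q \<partial>lborel)
      + (\<integral>\<^sup>+q. f u q * ?e u v \<partial>lborel) \<partial>lborel \<partial>lborel)"
    by (rule nn_integral_cong, rule nn_integral_cong, rule nn_integral_add) measurable
  also have "\<dots> = (\<integral>\<^sup>+u. (\<integral>\<^sup>+v. \<integral>\<^sup>+q. f u q * ?S y u v q \<partial>lborel \<partial>lborel)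
      + (\<integral>\<^sup>+v. \<integral>\<^sup>+q. f u q * ?e u v \<partial>lborel \<partial>lborel) \<partial>lborel)"
    by (rule nn_integral_cong, rule nn_integral_add) measurable
  also have "\<dots> = line_corr f y + (\<integral>\<^sup>+u. \<integral>\<^sup>+v. \<integral>\<^sup>+q. f u q * ?e u v \<partial>lborel \<partial>lborel \<partial>lborel)"
    unfolding line_corr_eq by (rule nn_integral_add) measurable
  also have "(\<integral>\<^sup>+u. \<integral>\<^sup>+v. \<integral>\<^sup>+q. f u q * ?e u v \<partial>lborel \<partial>lborel \<partial>lborel)
      = (\<integral>\<^sup>+u. \<integral>\<^sup>+v. (\<integral>\<^sup>+q. f u q \<partial>lborel) * ?e u v \<partial>lborel \<partial>lborel)"
    by (rule nn_integral_cong, rule nn_integral_cong, rule nn_integral_multc) measurable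
  also have "\<dots> = (\<integral>\<^sup>+u. (\<integral>\<^sup>+q. f u q \<partial>lborel) * (\<integral>\<^sup>+v. ?e u v \<partial>lborel) \<partial>lborel)"
    by (rule nn_integral_cong, rule nn_integral_cmult) measurable
  also have "\<dots> = total_mass f * ennreal (2 + R * \<bar>y\<bar>)"
    unfolding e total_mass_def by (simp add: nn_integral_multc)
  finally show ?thesis .
qed

text \<open>
  Finiteness is what permits cancelling correlations in the extended nonnegative reals below.
\<close>
lemma line_corr_0_finite:
  assumes "total_mass f < top"
  shows "line_corr f 0 < top"
proof -
  have "line_corr f 0 \<le> (\<integral>\<^sup>+u. \<integral>\<^sup>+v. \<integral>\<^sup>+q. f u q * indicator {0..R} v \<partial>lborel \<partial>lborel \<partial>lborel)"
    unfolding line_corr_eq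
  proof (intro nn_integral_mono mult_left_mono)
    fix u v q :: real
    have "(\<integral>\<^sup>+m. indicator {0..1} m * f v (q + 0 + m * (v - u)) \<partial>lborel)
        \<le> (\<integral>\<^sup>+m. indicator {0..1::real} m * indicator {0..R} v \<partial>lborel)"
      by (intro nn_integral_mono mult_left_mono)
         (use f_le1 f_supp in \<open>force simp: indicator_def\<close>)+
    then show "(\<integral>\<^sup>+m. indicator {0..1} m * f v (q + 0 + m * (v - u)) \<partial>lborel) \<le> indicator {0..R} v"
      by (simp add: nn_integral_multc)
  qed auto
  also have "\<dots> = total_mass f * ennreal R"
    using R_pos by (simp add: nn_integral_multc nn_integral_cmult total_mass_def)
  also have "\<dots> < top" using assms by (simp add: ennreal_mult_less_top)
  finally show ?thesis .
qed

text \<open>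
  The square of the difference of line mass and translated line mass integrates to
  \<open>2 (line_corr f 0 - line_corr f y)\<close>, and equals the square of the line mass wherever the
  translate is empty. The proof phrases this without subtraction: where the translate is nonempty
  it uses \<open>2 a b \<le> a\<^sup>2 + b\<^sup>2\<close>, where it is empty the product vanishes.
\<close>
lemma lines_with_empty_translate:
  assumes fin: "total_mass f < top"
  shows "(\<integral>\<^sup>+m. \<integral>\<^sup>+p. line_mass f p m * line_mass f p m * of_bool (line_mass f (p + y) m = 0)
            \<partial>lborel \<partial>lborel) \<le> 2 * (total_mass f * ennreal (2 + R * \<bar>y\<bar>))" (is "?W \<le> 2 * ?e")
proof -
  let ?G = "line_mass f"
  have [measurable]: "Measurable.pred (borel \<Otimes>\<^sub>M borel) (\<lambda>x. ?G (fst x + y) (snd x) = 0)"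
    by measurable
  have sq: "(\<integral>\<^sup>+m. \<integral>\<^sup>+p. ?G (p + y) m * ?G (p + y) m \<partial>lborel \<partial>lborel) = line_corr f 0"
    unfolding line_corr_def
    by (simp, intro nn_integral_cong nn_integral_translate[where g = "\<lambda>p. ?G p _ * ?G p _"]) measurable
  have "2 * line_corr f y + ?W = (\<integral>\<^sup>+m. \<integral>\<^sup>+p. 2 * (?G p m * ?G (p + y) m) +
       ?G p m * ?G p m * of_bool (?G (p + y) m = 0) \<partial>lborel \<partial>lborel)"
    unfolding line_corr_def by (simp add: nn_integral_add nn_integral_cmult)
  also have "\<dots> \<le> (\<integral>\<^sup>+m. \<integral>\<^sup>+p. ?G p m * ?G p m + ?G (p + y) m * ?G (p + y) m \<partial>lborel \<partial>lborel)"
    by (intro nn_integral_mono) (auto simp: ennreal_two_mult_le)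
  also have "\<dots> = line_corr f 0 + line_corr f 0"
    by (subst sq[symmetric], simp add: nn_integral_add line_corr_def)
  finally have A: "2 * line_corr f y + ?W \<le> 2 * line_corr f 0"
    by (simp add: mult_2)
  also have "\<dots> \<le> 2 * line_corr f y + 2 * ?e"
    using mult_left_mono[OF line_corr_shift[of y], of 2] by (simp add: distrib_left)
  finally have B: "2 * line_corr f y + ?W \<le> 2 * line_corr f y + 2 * ?e" .
  have "2 * line_corr f y \<le> 2 * line_corr f 0"
    using A by (meson add_increasing2 le_iff_add order.trans)
  also have "\<dots> < top" using line_corr_0_finite[OF fin] by (simp add: ennreal_mult_less_top)
  finally show ?thesis using B by (auto simp: ennreal_add_left_cancel_le)
qed

section \<open>Lines carrying much mass have many empty translates\<close>

text \<open>
  Fix one point \<open>u0\<close> of the chord. All other points \<open>u\<close> of the chord give empty translates for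
  \<open>s = u - u0\<close>, so the set of good \<open>s\<close> contains a translate of the chord apart from the part
  within \<open>t/4\<close> of \<open>u0\<close>. Discarding that part costs at most \<open>t/2\<close> and keeps the offset \<open>2/s\<close>
  below \<open>8/t\<close>.
\<close>
lemma empty_translates_measure:
  assumes sep: "\<And>p m u u' v. f u (p + m * u) \<noteq> 0 \<Longrightarrow> f u' (p + m * u') \<noteq> 0 \<Longrightarrow> u' \<noteq> u
      \<Longrightarrow> f v (p + 2 / (u' - u) + m * v) = 0"
    and t: "t > 0" "ennreal t \<le> line_mass f p m"
  shows "ennreal (t / 2) \<le> emeasure lborel {s. t / 4 \<le> \<bar>s\<bar> \<and> \<bar>s\<bar> \<le> R \<and> line_mass f (p + 2 / s) m = 0}"
    (is "_ \<le> emeasure _ ?E")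
proof -
  have [measurable]: "?E \<in> sets borel"
    by measurable
  define g where "g = (\<lambda>u. f u (p + m * u))"
  have [measurable]: "g \<in> borel_measurable borel"
    unfolding g_def by measurable
  have "line_mass f p m \<noteq> 0"
    using t by (metis ennreal_eq_0_iff le_zero_eq not_le)
  then have lm: "line_mass f p m = (\<integral>\<^sup>+u. g u \<partial>lborel)" and "(\<integral>\<^sup>+u. g u \<partial>lborel) \<noteq> 0"
    by (auto simp: line_mass_def g_def indicator_def split: if_splits)
  then obtain u0 where u0: "g u0 \<noteq> 0"
    by fastforce
  have "g u \<le> indicator {u0 - t / 4..u0 + t / 4} u + indicator ?E (u - u0)" for u
  proof (cases "g u = 0 \<or> u \<in> {u0 - t / 4..u0 + t / 4}")
    case True
    then show ?thesis using f_le1[of u] by (auto simp: g_def intro: add_increasing2)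
  next
    case False
    then have "u \<noteq> u0" and far: "t / 4 \<le> \<bar>u - u0\<bar>" using t by auto
    then have "f v (p + 2 / (u - u0) + m * v) = 0" for v
      using False u0 by (intro sep) (auto simp: g_def)
    then have "line_mass f (p + 2 / (u - u0)) m = 0"
      by (simp add: line_mass_def)
    moreover have "\<bar>u - u0\<bar> \<le> R"
      using f_supp[of u] f_supp[of u0] False u0 by (force simp: g_def)
    ultimately have "u - u0 \<in> ?E" using far by simp
    then show ?thesis using f_le1[of u] by (auto simp: g_def intro: add_increasing)
  qed
  then have "line_mass f p m \<le> (\<integral>\<^sup>+u. indicator {u0 - t / 4..u0 + t / 4} u + indicator ?E (u - u0) \<partial>lborel)"
    unfolding lm by (rule nn_integral_mono)
  also have "\<dots> = (\<integral>\<^sup>+u. indicator {u0 - t / 4..u0 + t / 4} u \<partial>lborel)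
      + (\<integral>\<^sup>+u. indicator ?E (u - u0) \<partial>lborel)"
    by (rule nn_integral_add) measurable
  also have "(\<integral>\<^sup>+u. indicator ?E (u - u0) \<partial>lborel) = (\<integral>\<^sup>+u. indicator ?E u \<partial>lborel)"
    using nn_integral_translate[of "indicator ?E" "-u0"] by simp
  finally have "line_mass f p m \<le> ennreal (t / 2) + emeasure lborel ?E"
    using t by simp
  then have "ennreal (t / 2) + ennreal (t / 2) \<le> ennreal (t / 2) + emeasure lborel ?E"
    using t by (simp flip: ennreal_plus)
  then show ?thesis by (simp only: ennreal_add_left_cancel_le) auto
qed

text \<open>
  Lines of slope in \<open>[0, 1]\<close> that meet the square have intercept in \<open>[-R, R]\<close>, so those with mass
  below \<open>t\<close> carry at most \<open>2 R t\<close> altogether.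
\<close>
lemma total_mass_le_thick_lines:
  assumes t: "t > 0"
  shows "total_mass f \<le> (\<integral>\<^sup>+m. \<integral>\<^sup>+p. line_mass f p m * of_bool (ennreal t \<le> line_mass f p m)
      \<partial>lborel \<partial>lborel) + ennreal (2 * R * t)" (is "_ \<le> ?X + _")
proof -
  have [measurable]: "Measurable.pred (borel \<Otimes>\<^sub>M borel) (\<lambda>x. ennreal t \<le> line_mass f (snd x) (fst x))"
    by measurable
  have "line_mass f p m \<le> line_mass f p m * of_bool (ennreal t \<le> line_mass f p m)
      + ennreal t * indicator {-R..R} p * indicator {0..1::real} m" for p m
  proof (cases "line_mass f p m = 0")
    case False
    then have m: "m \<in> {0..1}" and "(\<integral>\<^sup>+u. f u (p + m * u) \<partial>lborel) \<noteq> 0"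
      by (auto simp: line_mass_def indicator_def split: if_splits)
    then obtain u where "f u (p + m * u) \<noteq> 0"
      by fastforce
    then have "u \<in> {0..R}" "p + m * u \<in> {0..R}" using f_supp by blast+
    moreover have "0 \<le> m * u" "m * u \<le> 1 * R"
      using m calculation mult_mono[of m 1 u R] by auto
    ultimately have "p \<in> {-R..R}" by simp
    then show ?thesis using m by (cases "ennreal t \<le> line_mass f p m") auto
  qed simp
  then have "total_mass f \<le> (\<integral>\<^sup>+m. \<integral>\<^sup>+p. line_mass f p m * of_bool (ennreal t \<le> line_mass f p m)
      + ennreal t * indicator {-R..R} p * indicator {0..1::real} m \<partial>lborel \<partial>lborel)"
    unfolding integral_line_mass[symmetric] by (intro nn_integral_mono)
  also have "\<dots> = (\<integral>\<^sup>+m. (\<integral>\<^sup>+p. line_mass f p m * of_bool (ennreal t \<le> line_mass f p m) \<partial>lborel)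
      + (\<integral>\<^sup>+p. ennreal t * indicator {-R..R} p * indicator {0..1::real} m \<partial>lborel) \<partial>lborel)"
    by (rule nn_integral_cong, rule nn_integral_add) measurable
  also have "\<dots> = ?X + (\<integral>\<^sup>+m. \<integral>\<^sup>+p. ennreal t * indicator {-R..R} p * indicator {0..1::real} m \<partial>lborel \<partial>lborel)"
    by (rule nn_integral_add) measurable
  also have "(\<integral>\<^sup>+m. \<integral>\<^sup>+p. ennreal t * indicator {-R..R} p * indicator {0..1::real} m \<partial>lborel \<partial>lborel)
      = ennreal (2 * R * t)"
    using R_pos t by (simp add: nn_integral_multc nn_integral_cmult mult.commute flip: ennreal_mult)
  finally show ?thesis .
qed

lemma total_mass_le_square: "total_mass f \<le> ennreal (R * R)"
proof -
  have "total_mass f \<le> (\<integral>\<^sup>+u. \<integral>\<^sup>+q. indicator {0..R} u * indicator {0..R} q \<partial>lborel \<partial>lborel)"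
    unfolding total_mass_def
  proof (intro nn_integral_mono)
    fix u q :: real
    show "f u q \<le> indicator {0..R} u * indicator {0..R} q"
      using f_le1[of u q] f_supp[of u q] by (cases "f u q = 0") auto
  qed
  also have "\<dots> = ennreal (R * R)"
    using R_pos by (simp add: nn_integral_multc nn_integral_cmult flip: ennreal_mult)
  finally show ?thesis .
qed

text \<open>
  Both properties are compared through the integral, over offsets \<open>2/s\<close> and lines, of the squared
  mass of the lines whose translate by \<open>2/s\<close> is empty.
\<close>
theorem total_mass_cubed_le:
  assumes sep: "\<And>p m u u' v. f u (p + m * u) \<noteq> 0 \<Longrightarrow> f u' (p + m * u') \<noteq> 0 \<Longrightarrow> u' \<noteq> u
      \<Longrightarrow> f v (p + 2 / (u' - u) + m * v) = 0"
    and a: "total_mass f = ennreal a" "a \<ge> 0"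
  shows "a ^ 3 \<le> 8704 * R ^ 5"
proof (cases "a = 0")
  case False
  then have a_pos: "a > 0" using a by simp
  \<comment> \<open>Lines of mass below this \<open>t\<close> carry at most half of the total mass.\<close>
  define t where "t = a / (4 * R)"
  have t: "t > 0" using a_pos R_pos by (simp add: t_def)
  have a_eq: "a = 4 * R * t" using R_pos by (simp add: t_def)
  let ?G = "line_mass f"
  define S where "S = {s::real. t / 4 \<le> \<bar>s\<bar> \<and> \<bar>s\<bar> \<le> R}"
  have [measurable]: "S \<in> sets borel" unfolding S_def by measurable
  define K where "K = 2 + 8 * R / t"
  have K: "K > 0" using R_pos t by (simp add: K_def add_pos_pos)
  define Q where "Q = (\<lambda>s m p. ?G p m * ?G p m * of_bool (?G (p + 2 / s) m = 0) * indicator S s)"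
  have [measurable]: "Measurable.pred (borel \<Otimes>\<^sub>M borel) (\<lambda>x. ennreal t \<le> ?G (snd x) (fst x))"
    by measurable
  have Q_meas [measurable (raw)]: "(\<lambda>x. Q (s x) (m x) (p x)) \<in> borel_measurable M"
    if [measurable]: "s \<in> borel_measurable M" "m \<in> borel_measurable M" "p \<in> borel_measurable M"
    for s m p and M :: "'z measure"
    unfolding Q_def by measurable
  have upper: "(\<integral>\<^sup>+s. \<integral>\<^sup>+m. \<integral>\<^sup>+p. Q s m p \<partial>lborel \<partial>lborel \<partial>lborel) \<le> ennreal (4 * R * a * K)"
  proof -
    have "(\<integral>\<^sup>+m. \<integral>\<^sup>+p. Q s m p \<partial>lborel \<partial>lborel) \<le> ennreal (2 * a * K) * indicator {-R..R} s" for s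
    proof (cases "s \<in> S")
      case True
      have "(\<integral>\<^sup>+m. \<integral>\<^sup>+p. Q s m p \<partial>lborel \<partial>lborel) \<le> 2 * (total_mass f * ennreal (2 + R * \<bar>2 / s\<bar>))"
        using lines_with_empty_translate[of "2 / s"] True by (simp add: Q_def a)
      also have "\<dots> = ennreal (2 * a * (2 + R * \<bar>2 / s\<bar>))"
        using R_pos a by (simp add: mult.assoc ennreal_mult del: ennreal_plus)
      also have "\<bar>2 / s\<bar> \<le> 8 / t"
        using frac_le[of 2 2 "t / 4" "\<bar>s\<bar>"] True t by (simp add: S_def)
      then have "ennreal (2 * a * (2 + R * \<bar>2 / s\<bar>)) \<le> ennreal (2 * a * K)"
        using a R_pos mult_left_mono[of "\<bar>2 / s\<bar>" "8 / t" R]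
        by (intro ennreal_leI mult_left_mono) (auto simp: K_def mult.commute)
      finally show ?thesis using True by (simp add: S_def indicator_def abs_le_iff) 
    qed (simp add: Q_def)
    then have "(\<integral>\<^sup>+s. \<integral>\<^sup>+m. \<integral>\<^sup>+p. Q s m p \<partial>lborel \<partial>lborel \<partial>lborel)
        \<le> (\<integral>\<^sup>+s. ennreal (2 * a * K) * indicator {-R..R} s \<partial>lborel)"
      by (rule nn_integral_mono)
    also have "\<dots> = ennreal (2 * a * K) * ennreal (2 * R)"
      using R_pos by (subst nn_integral_cmult) auto
    also have "\<dots> = ennreal (4 * R * a * K)"
      using R_pos a K by (subst ennreal_mult[symmetric]) (auto simp: mult_ac)
    finally show ?thesis .
  qed
  have lower: "ennreal (t * t / 2) * (\<integral>\<^sup>+m. \<integral>\<^sup>+p. ?G p m * of_bool (ennreal t \<le> ?G p m) \<partial>lborel \<partial>lborel)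
      \<le> (\<integral>\<^sup>+s. \<integral>\<^sup>+m. \<integral>\<^sup>+p. Q s m p \<partial>lborel \<partial>lborel \<partial>lborel)"
  proof -
    have "(\<integral>\<^sup>+s. Q s m p \<partial>lborel)
        = ?G p m * ?G p m * emeasure lborel {s. t / 4 \<le> \<bar>s\<bar> \<and> \<bar>s\<bar> \<le> R \<and> ?G (p + 2 / s) m = 0}" for m p
    proof -
      have "Q s m p = ?G p m * ?G p m * indicator {s. t / 4 \<le> \<bar>s\<bar> \<and> \<bar>s\<bar> \<le> R \<and> ?G (p + 2 / s) m = 0} s" for s
        by (auto simp: Q_def S_def indicator_def)
      then show ?thesis by (simp add: nn_integral_cmult)
    qed
    moreover have "ennreal (t * t / 2) * (?G p m * of_bool (ennreal t \<le> ?G p m))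
      \<le> ?G p m * ?G p m * emeasure lborel {s. t / 4 \<le> \<bar>s\<bar> \<and> \<bar>s\<bar> \<le> R \<and> ?G (p + 2 / s) m = 0}" for m p
    proof (cases "ennreal t \<le> ?G p m")
      case True
      have "ennreal (t * t / 2) = ennreal t * ennreal (t / 2)"
        using t by (subst ennreal_mult[symmetric]) auto
      then have "ennreal (t * t / 2) * ?G p m = ennreal t * ?G p m * ennreal (t / 2)"
        by (simp only: mult_ac)
      also have "\<dots> \<le> ?G p m * ?G p m * emeasure lborel {s. t / 4 \<le> \<bar>s\<bar> \<and> \<bar>s\<bar> \<le> R \<and> ?G (p + 2 / s) m = 0}"
        by (intro mult_mono empty_translates_measure sep t True) auto
      finally show ?thesis using True by simp
    qed simp
    ultimately have "ennreal (t * t / 2) * (?G p m * of_bool (ennreal t \<le> ?G p m)) \<le> (\<integral>\<^sup>+s. Q s m p \<partial>lborel)"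
      for m p by simp
    then have "(\<integral>\<^sup>+m. \<integral>\<^sup>+p. ennreal (t * t / 2) * (?G p m * of_bool (ennreal t \<le> ?G p m)) \<partial>lborel \<partial>lborel)
        \<le> (\<integral>\<^sup>+m. \<integral>\<^sup>+p. \<integral>\<^sup>+s. Q s m p \<partial>lborel \<partial>lborel \<partial>lborel)"
      by (intro nn_integral_mono)
    also have "\<dots> = (\<integral>\<^sup>+m. \<integral>\<^sup>+s. \<integral>\<^sup>+p. Q s m p \<partial>lborel \<partial>lborel \<partial>lborel)"
      by (rule nn_integral_cong, rule nn_integral_swap) measurable
    also have "\<dots> = (\<integral>\<^sup>+s. \<integral>\<^sup>+m. \<integral>\<^sup>+p. Q s m p \<partial>lborel \<partial>lborel \<partial>lborel)"
      by (rule nn_integral_swap) measurable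
    finally show ?thesis by (simp add: nn_integral_cmult)
  qed
  have "ennreal (a / 2) + ennreal (a / 2)
      \<le> ennreal (a / 2) + (\<integral>\<^sup>+m. \<integral>\<^sup>+p. ?G p m * of_bool (ennreal t \<le> ?G p m) \<partial>lborel \<partial>lborel)"
    using total_mass_le_thick_lines[OF t] a by (simp add: a_eq add.commute mult.assoc flip: ennreal_plus)
  then have "ennreal (a / 2) \<le> (\<integral>\<^sup>+m. \<integral>\<^sup>+p. ?G p m * of_bool (ennreal t \<le> ?G p m) \<partial>lborel \<partial>lborel)"
    by (simp only: ennreal_add_left_cancel_le) auto
  then have "ennreal (t * t / 2) * ennreal (a / 2) \<le> ennreal (4 * R * a * K)"
    using lower upper by (meson mult_left_mono order.trans zero_le)
  then have "t * t / 2 * (a / 2) \<le> 4 * R * a * K"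
    using a t R_pos K by (simp flip: ennreal_mult)
  then have "t * t \<le> 16 * R * K"
    using a_pos by (simp add: field_simps)
  then have "t * t * t \<le> 16 * R * K * t"
    using t by (intro mult_right_mono) auto
  also have "\<dots> = 16 * R * (2 * t + 8 * R)"
    using t by (simp add: K_def field_simps)
  also have "\<dots> \<le> 16 * R * (17 / 2 * R)"
  proof -
    have "4 * R * t \<le> R * R"
      using total_mass_le_square R_pos unfolding a a_eq by simp
    then have "2 * t \<le> R / 2" using R_pos by simp
    then show ?thesis using R_pos by (intro mult_left_mono) auto
  qed
  finally have "t ^ 3 \<le> 136 * R ^ 2" by (simp add: power2_eq_square power3_eq_cube)
  then have "64 * R ^ 3 * t ^ 3 \<le> 64 * R ^ 3 * (136 * R ^ 2)"
    using R_pos by (intro mult_left_mono) auto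
  then show ?thesis unfolding a_eq by (simp add: power_mult_distrib eval_nat_numeral mult_ac)
qed (use R_pos in auto)

end


section \<open>Planar sets and unit triangles\<close>

definition point :: "real \<Rightarrow> real \<Rightarrow> real^2" where "point u q = vector [u, q]"

lemma point_nth [simp]: "point u q $ 1 = u" "point u q $ 2 = q"
  by (simp_all add: point_def)

lemma point_measurable [measurable]:
  "(\<lambda>(u, q). point u q) \<in> borel_measurable (borel \<Otimes>\<^sub>M borel)"
proof -
  have "point u q = u *\<^sub>R axis 1 1 + q *\<^sub>R axis 2 1" for u q
    by (simp add: vec_eq_iff forall_2 axis_def)
  then show ?thesis by (simp add: case_prod_beta)
qed

lemma lborel_eq_distr_point:
  "(lborel :: (real^2) measure) = distr (lborel \<Otimes>\<^sub>M lborel) borel (\<lambda>(u, q). point u q)"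
proof (rule lborel_eqI)
  fix l v :: "real^2"
  assume le: "\<And>b. b \<in> Basis \<Longrightarrow> l \<bullet> b \<le> v \<bullet> b"
  have "l $ i \<le> v $ i" for i
    using le[of "axis i 1"] by (auto simp: inner_axis Basis_vec_def)
  note le = this
  have "(\<lambda>(u, q). point u q) -` box l v \<inter> space (lborel \<Otimes>\<^sub>M lborel)
      = {l $ 1<..<v $ 1} \<times> {l $ 2<..<v $ 2}"
    by (auto simp: mem_box_cart forall_2 space_pair_measure)
  moreover have "(\<lambda>(u, q). point u q) \<in> measurable (lborel \<Otimes>\<^sub>M lborel) borel"
    using point_measurable by measurable
  ultimately have "emeasure (distr (lborel \<Otimes>\<^sub>M lborel) borel (\<lambda>(u, q). point u q)) (box l v)
      = ennreal (v $ 1 - l $ 1) * ennreal (v $ 2 - l $ 2)"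
    using le by (simp add: emeasure_distr lborel.emeasure_pair_measure_Times)
  also have "\<dots> = ennreal (\<Prod>i\<in>UNIV. v $ i - l $ i)"
    using le by (simp add: UNIV_2 ennreal_mult)
  also have "(\<Prod>i\<in>UNIV. v $ i - l $ i) = (\<Prod>b\<in>Basis. (v - l) \<bullet> b)"
  proof -
    have "(Basis :: (real^2) set) = {axis 1 1, axis 2 1}"
      by (auto simp: Basis_vec_def UNIV_2)
    then have "(\<Prod>b\<in>Basis. (v - l) \<bullet> b) = (\<Prod>b\<in>{axis 1 1, axis 2 1}. (v - l) \<bullet> b)"
      by (rule arg_cong)
    then show ?thesis
      by (simp add: UNIV_2 axis_eq_axis inner_axis)
  qed
  finally show "emeasure (distr (lborel \<Otimes>\<^sub>M lborel) borel (\<lambda>(u, q). point u q)) (box l v)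
      = ennreal (\<Prod>b\<in>Basis. (v - l) \<bullet> b)" .
qed simp

lemma emeasure_eq_iterated:
  assumes [measurable]: "A \<in> sets borel"
  shows "emeasure lborel A = (\<integral>\<^sup>+u. \<integral>\<^sup>+q. indicator A (point u q) \<partial>lborel \<partial>lborel)"
proof -
  have [measurable]: "(\<lambda>(u, q). point u q) \<in> measurable (lborel \<Otimes>\<^sub>M lborel) borel"
    using point_measurable by measurable
  have "emeasure lborel A = (\<integral>\<^sup>+x. indicator A x \<partial>distr (lborel \<Otimes>\<^sub>M lborel) borel (\<lambda>(u, q). point u q))"
    by (subst lborel_eq_distr_point) simp
  also have "\<dots> = (\<integral>\<^sup>+z. indicator A (case z of (u, q) \<Rightarrow> point u q) \<partial>(lborel \<Otimes>\<^sub>M lborel))"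
    by (rule nn_integral_distr) auto
  also have "\<dots> = (\<integral>\<^sup>+u. \<integral>\<^sup>+q. indicator A (point u q) \<partial>lborel \<partial>lborel)"
    by (subst lborel.nn_integral_fst[symmetric]) auto
  finally show ?thesis .
qed

text \<open>
  The third vertex is at vertical distance \<open>2 / (u' - u)\<close> from the line through the other two, and
  the area is half of this distance times the horizontal extent \<open>u' - u\<close> of the base, wherever
  the third vertex sits on its parallel line.
\<close>
lemma triangle_area_strip:
  assumes "u' \<noteq> u"
  shows "triangle_area (point u (p + m * u)) (point u' (p + m * u')) (point v (p + 2 / (u' - u) + m * v)) = 1"
proof -
  have "(v - u) * ((p + m * u') - (p + m * u)) - (u' - u) * ((p + 2 / (u' - u) + m * v) - (p + m * u)) = - 2"
    using assms by (simp add: field_simps)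
  then have "measure lborel (convex hull {point u (p + m * u), point u' (p + m * u'),
      point v (p + 2 / (u' - u) + m * v)}) = 1"
    unfolding content_triangle point_nth by simp
  then show ?thesis
    by (simp add: triangle_area_def measure_completion finite_imp_compact_convex_hull borel_compact)
qed

text \<open>
  Passing to a Borel subset keeps the absence of unit triangles and makes the iterated integrals
  over \<^typ>\<open>real^2\<close> available without completing product measures.
\<close>
lemma borel_subset_same_measure:
  fixes A :: "(real^2) set"
  assumes "A \<in> sets lebesgue"
  obtains B where "B \<subseteq> A" "B \<in> sets borel" "measure lebesgue A = measure lborel B"
proof -
  obtain B T where B: "fsigma B" "T \<in> null_sets lebesgue" "B \<union> T = A" "disjnt B T"
    using lebesgue_set_almost_fsigma[OF assms] .
  obtain F :: "nat \<Rightarrow> (real^2) set" where "range F \<subseteq> Collect compact" "B = \<Union> (range F)"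
    using B(1) fsigma_Union_compact[of B] by auto
  then have meas: "B \<in> sets borel"
    by (simp only:) (rule sets.countable_UN, auto intro: borel_compact)
  have "measure lebesgue A = measure lebesgue B"
    using B meas measure_Un_null_set[of B lebesgue T] by simp
  then show thesis using that[of B] meas B(3) by (auto simp: measure_completion)
qed

theorem admissible_measure_cubed_le:
  assumes R: "R > 0" and A: "A \<in> admissible R"
  shows "measure lebesgue A ^ 3 \<le> 8704 * R ^ 5"
proof -
  have "A \<in> sets lebesgue" using A by (simp add: admissible_def)
  then obtain B where B: "B \<subseteq> A" "B \<in> sets borel" "measure lebesgue A = measure lborel B"
    by (rule borel_subset_same_measure)
  note [measurable] = B(2)
  define f :: "real \<Rightarrow> real \<Rightarrow> ennreal" where "f = (\<lambda>u q. indicator B (point u q))"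
  have nz: "f u q \<noteq> 0 \<longleftrightarrow> point u q \<in> B" for u q
    by (simp add: f_def indicator_def)
  have B_square: "B \<subseteq> square R" using A B(1) by (auto simp: admissible_def)
  interpret planar_density f R
  proof
    show "(\<lambda>(u, q). f u q) \<in> borel_measurable (borel \<Otimes>\<^sub>M borel)"
      unfolding f_def by measurable
    show "f u q \<le> 1" for u q by (simp add: f_def indicator_def)
    show "u \<in> {0..R} \<and> q \<in> {0..R}" if "f u q \<noteq> 0" for u q
    proof -
      have "point u q \<in> square R" using that B_square nz by blast
      then show ?thesis by (simp add: square_def forall_2)
    qed
  qed (use R in auto)
  have mass: "total_mass f = emeasure lborel B"
    by (simp add: total_mass_def f_def emeasure_eq_iterated)
  then have "emeasure lborel B < top"
    using total_mass_le_square by (auto intro: le_less_trans)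
  then have "total_mass f = ennreal (measure lborel B)"
    unfolding mass by (intro emeasure_eq_ennreal_measure) auto
  moreover have "f v (p + 2 / (u' - u) + m * v) = 0"
    if "f u (p + m * u) \<noteq> 0" "f u' (p + m * u') \<noteq> 0" "u' \<noteq> u" for p m u u' v
  proof (rule ccontr)
    assume "f v (p + 2 / (u' - u) + m * v) \<noteq> 0"
    then have "point u (p + m * u) \<in> A" "point u' (p + m * u') \<in> A"
      "point v (p + 2 / (u' - u) + m * v) \<in> A"
      using that B(1) by (auto simp: nz)
    then show False
      using A triangle_area_strip[OF that(3), of p m v]
      by (auto simp: admissible_def avoids_unit_triangles_def)
  qed
  ultimately have "measure lborel B ^ 3 \<le> 8704 * R ^ 5"
    by (intro total_mass_cubed_le) auto
  then show ?thesis by (simp only: B(3))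
qed

section \<open>The logarithmic bound\<close>

text \<open>
  The logarithm obeys \<open>ln R \<le> 3/2 R\<^sup>2\<^sup>/\<^sup>3\<close>, while \<open>ln (ln R)\<close> is bounded below because
  \<open>10 > e\<^sup>2\<close>.
\<close>
lemma powr_minus_third_le_log_rate:
  fixes R :: real
  assumes "R \<ge> 10"
  shows "R powr (- 1/3) \<le> 2 * (ln (ln R) / ln R) powr (1/2)"
proof -
  have pow: "R powr (- 1/3) = (R powr (- 2/3)) powr (1/2)"
    using assms by (simp add: powr_powr)
  have "exp (2::real) = exp 1 * exp 1"
    by (simp flip: exp_add)
  also have "\<dots> \<le> 3 * 3"
    by (intro mult_mono exp_le) auto
  finally have "ln (exp (2::real)) \<le> ln R"
    using assms by (intro ln_mono) auto
  then have ln: "2 \<le> ln R" by simp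
  then have "ln 2 \<le> ln (ln R)" by (subst ln_le_cancel_iff) auto
  then have lnln: "1/2 \<le> ln (ln R)" using ln2_ge_two_thirds by simp
  have "2/3 * ln R = ln (R powr (2/3))"
    using assms by (simp add: ln_powr)
  also have "\<dots> \<le> R powr (2/3)"
    using assms by (intro ln_bound) auto
  finally have "ln R \<le> 3/2 * R powr (2/3)" by simp
  then have "R powr (- 2/3) * ln R \<le> R powr (- 2/3) * (3/2 * R powr (2/3))"
    by (intro mult_left_mono) auto
  also have "\<dots> = 3/2" using assms by (simp flip: powr_add)
  also have "\<dots> \<le> 4 * ln (ln R)" using lnln by simp
  finally have "R powr (- 2/3) \<le> 4 * (ln (ln R) / ln R)"
    using ln by (simp add: field_simps)
  then have "R powr (- 1/3) \<le> (4 * (ln (ln R) / ln R)) powr (1/2)"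
    unfolding pow by (intro powr_mono2) auto
  also have "\<dots> = 4 powr (1/2) * (ln (ln R) / ln R) powr (1/2)"
    using ln lnln by (intro powr_mult)
  also have "4 powr (1/2) = (2::real)"
    by (simp add: powr_half_sqrt)
  finally show ?thesis .
qed

theorem theorem2:
  shows "\<exists>C>0. \<forall>R\<ge>10. M_Delta R \<le> C * R^2 * (ln (ln R) / ln R) powr (1/2)"
proof (intro exI[of _ 42] conjI allI impI)
  \<comment> \<open>The constant is \<open>21 * 2\<close>, where \<open>21\<^sup>3 = 9261\<close> exceeds the 8704 of the power bound.\<close>
  fix R :: real assume R: "R \<ge> 10"
  show "M_Delta R \<le> 42 * R^2 * (ln (ln R) / ln R) powr (1/2)"
    unfolding M_Delta_def
  proof (rule cSUP_least[OF admissible_nonempty])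
    fix A assume A: "A \<in> admissible R"
    have "(R powr (- 1/3)) ^ 3 = R powr (-1)"
      using R by (subst powr_power) auto
    then have cube: "(R powr (- 1/3)) ^ 3 = 1 / R"
      using R by (simp only: powr_minus_divide) simp
    have "(21 * R^2 * R powr (- 1/3)) ^ 3 = 9261 * R ^ 6 * (R powr (- 1/3)) ^ 3"
      by (simp only: power_mult_distrib power_mult[symmetric]) simp
    also have "\<dots> = 9261 * (R ^ 6 / R)"
      unfolding cube by simp
    also have "R ^ 6 / R = R ^ 5"
      using R by (simp add: eval_nat_numeral)
    finally have "(21 * R^2 * R powr (- 1/3)) ^ 3 = 9261 * R ^ 5" .
    moreover have "measure lebesgue A ^ 3 \<le> 8704 * R ^ 5"
      using admissible_measure_cubed_le[of R A] A R by simp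
    moreover have "8704 * R ^ 5 \<le> 9261 * R ^ 5"
      using R by (intro mult_right_mono) auto
    ultimately have "measure lebesgue A ^ 3 \<le> (21 * R^2 * R powr (- 1/3)) ^ 3"
      by linarith
    then have "measure lebesgue A \<le> 21 * R^2 * R powr (- 1/3)"
      by (subst (asm) power_mono_iff) auto
    also have "\<dots> \<le> 21 * R^2 * (2 * (ln (ln R) / ln R) powr (1/2))"
      using powr_minus_third_le_log_rate[OF R] by (intro mult_left_mono) auto
    finally show "measure lebesgue A \<le> 42 * R^2 * (ln (ln R) / ln R) powr (1/2)"
      by simp
  qed
qed simp

end
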